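(* Let $n\geq 2$ and let $\mathbb{K}$ be a field. Let $f\colon \mathscr{B}\to\mathscr{A}$ be an extension (surjective homomorphism) of Leibniz $n$-algebras over $\mathbb{K}$, with kernel $\mathscr{K}$. Then $f$ is central (with respect to the subcategory of $\mathbb{K}$-vector spaces, i.e. abelian Leibniz $n$-algebras) if and only if the ideal $[\mathscr{K},\mathscr{B},\dots,\mathscr{B}]$ of $\mathscr{B}$ is zero. Hence, for any extension $f$ (central or not), the object $L_{1}[f]$, viewed as an ideal of $\mathscr{B}$, is equal to $[\mathscr{K},\mathscr{B},\dots,\mathscr{B}]$.
   Context: A Leibniz $n$-algebra over $\mathbb{K}$ is a $\mathbb{K}$-vector space $\mathscr{L}$ with an $n$-linear operation $[-,\dots,-]\colon\mathscr{L}^n\to\mathscr{L}$ satisfying $$[[l_{1},\dots,l_{n}],l'_{1},\dots,l'_{n-1}]=\sum_{1\leq i\leq n}[l_{1},\dots,l_{i-1},[l_{i},l'_{1},\dots,l'_{n-1}],l_{i+1},\dots,l_{n}].$$ Homomorphisms are linear maps preserving the bracket. Ideals are $n$-sided: a subspace $\mathscr{N}$ such that $[l_1,\dots,l_n]\in\mathscr{N}$ whenever some $l_i\in\mathscr{N}$; these are exactly the kernels of homomorphisms. A vector space is regarded as a Leibniz $n$-algebra with zero bracket ("abelian"). For ideals $\mathscr{N}_1,\dots,\mathscr{N}_n$ of $\mathscr{L}$, $[\mathscr{N}_1,\dots,\mathscr{N}_n]$ denotes the ideal of $\mathscr{L}$ generated by the elements $[l_1,\dots,l_n]$ where $(l_1,\dots,l_n)$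 or any of its permutations is in $\mathscr{N}_1\times\dots\times\mathscr{N}_n$. The left adjoint of the inclusion of vector spaces into Leibniz $n$-algebras is $\mathscr{L}\mapsto\mathscr{L}/[\mathscr{L},\dots,\mathscr{L}]$; put $L_0[\mathscr{L}]=[\mathscr{L},\dots,\mathscr{L}]$. Let $R[f]=\{(x,y)\in\mathscr{B}\times\mathscr{B}: f(x)=f(y)\}$ with projections $f_0,f_1\colon R[f]\to\mathscr{B}$, $f_0(x,y)=x$, $f_1(x,y)=y$. The extension $f$ is central when the restrictions of $f_0$ and $f_1$ to maps $L_0[R[f]]\to L_0[\mathscr{B}]$ coincide. The object $L_1[f]$ is the kernel of the restriction $L_0[R[f]]\to L_0[\mathscr{B}]$ of $f_0$, viewed as an ideal of $\mathscr{B}$ via $f_1$; that is, $L_1[f]=\{k\in\mathscr{B}: (0,k)\in L_0[R[f]]\}$. *)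

theory Defs
  imports Complex_Main "HOL-Library.Multiset" "HOL-Library.Product_Plus"
begin

text \<open>
  A Leibniz algebra lives on a subset of an ambient vector space, so that an algebra and a
  subalgebra of its square (such as a kernel pair) are objects of the same kind. The
  \<open>n\<close>-ary bracket is a function on lists, of which only the lists of length \<open>n\<close> with entries in
  the carrier matter.
\<close>

record ('k, 'a) leibniz_struct =
  lcarrier :: "'a set"
  lscale :: "'k \<Rightarrow> 'a \<Rightarrow> 'a"
  lbracket :: "'a list \<Rightarrow> 'a"

definition tuples :: "nat \<Rightarrow> 'a set \<Rightarrow> 'a list set" where
  "tuples n X = {xs. length xs = n \<and> set xs \<subseteq> X}"

locale leibniz_algebra = vector_space "lscale L"
  for n :: nat and L :: "('k::field, 'a::ab_group_add) leibniz_struct" +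
  assumes subspace_carrier: "subspace (lcarrier L)"
    and bracket_closed: "xs \<in> tuples n (lcarrier L) \<Longrightarrow> lbracket L xs \<in> lcarrier L"
    and bracket_add: "\<lbrakk>xs \<in> tuples n (lcarrier L); i < n; x \<in> lcarrier L; y \<in> lcarrier L\<rbrakk> \<Longrightarrow>
      lbracket L (xs[i := x + y]) = lbracket L (xs[i := x]) + lbracket L (xs[i := y])"
    and bracket_scale: "\<lbrakk>xs \<in> tuples n (lcarrier L); i < n; x \<in> lcarrier L\<rbrakk> \<Longrightarrow>
      lbracket L (xs[i := lscale L c x]) = lscale L c (lbracket L (xs[i := x]))"
    and leibniz_identity:
      "\<lbrakk>xs \<in> tuples n (lcarrier L); ys \<in> tuples (n - 1) (lcarrier L)\<rbrakk> \<Longrightarrow>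
      lbracket L (lbracket L xs # ys) =
        (\<Sum>i<n. lbracket L (xs[i := lbracket L (xs ! i # ys)]))"

definition leibniz_hom ::
  "nat \<Rightarrow> ('k, 'b::ab_group_add) leibniz_struct \<Rightarrow> ('k, 'a::ab_group_add) leibniz_struct \<Rightarrow>
    ('b \<Rightarrow> 'a) \<Rightarrow> bool" where
  "leibniz_hom n B A f \<longleftrightarrow>
     f ` lcarrier B \<subseteq> lcarrier A \<and>
     (\<forall>x\<in>lcarrier B. \<forall>y\<in>lcarrier B. f (x + y) = f x + f y) \<and>
     (\<forall>c. \<forall>x\<in>lcarrier B. f (lscale B c x) = lscale A c (f x)) \<and>
     (\<forall>xs\<in>tuples n (lcarrier B). f (lbracket B xs) = lbracket A (map f xs))"

locale leibniz_extension = B: leibniz_algebra n B + A: leibniz_algebra n A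
  for n :: nat
    and B :: "('k::field, 'b::ab_group_add) leibniz_struct"
    and A :: "('k, 'a::ab_group_add) leibniz_struct"
    and f :: "'b \<Rightarrow> 'a" +
  assumes hom: "leibniz_hom n B A f"
    and surj: "f ` lcarrier B = lcarrier A"

definition leibniz_kernel ::
  "('k, 'b) leibniz_struct \<Rightarrow> ('b \<Rightarrow> 'a::zero) \<Rightarrow> 'b set" where
  "leibniz_kernel B f = {x \<in> lcarrier B. f x = 0}"

definition leibniz_ideal ::
  "nat \<Rightarrow> ('k::field, 'a::ab_group_add) leibniz_struct \<Rightarrow> 'a set \<Rightarrow> bool" where
  "leibniz_ideal n L N \<longleftrightarrow>
     N \<subseteq> lcarrier L \<and> module.subspace (lscale L) N \<and>
     (\<forall>xs\<in>tuples n (lcarrier L). (\<exists>i<n. xs ! i \<in> N) \<longrightarrow> lbracket L xs \<in> N)"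

text \<open>
  The commutator ideal of a list \<open>Ns\<close> of \<open>n\<close> ideals; \<open>leibniz_ideal n L hull S\<close> is the smallest
  ideal of \<open>L\<close> containing \<open>S\<close>.
\<close>

definition commutator ::
  "nat \<Rightarrow> ('k::field, 'a::ab_group_add) leibniz_struct \<Rightarrow> 'a set list \<Rightarrow> 'a set" where
  "commutator n L Ns = leibniz_ideal n L hull
     {lbracket L xs | xs ys. mset ys = mset xs \<and> list_all2 (\<in>) ys Ns}"

definition L0 :: "nat \<Rightarrow> ('k::field, 'a::ab_group_add) leibniz_struct \<Rightarrow> 'a set" where
  "L0 n L = commutator n L (replicate n (lcarrier L))"

text \<open>The kernel pair \<open>R[f]\<close>; its two projections are \<^const>\<open>fst\<close> and \<^const>\<open>snd\<close>.\<close>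

definition kernel_pair ::
  "('k, 'b) leibniz_struct \<Rightarrow> ('b \<Rightarrow> 'a) \<Rightarrow> ('k, 'b \<times> 'b) leibniz_struct" where
  "kernel_pair B f =
     \<lparr>lcarrier = {(x, y). x \<in> lcarrier B \<and> y \<in> lcarrier B \<and> f x = f y},
      lscale = (\<lambda>c z. (lscale B c (fst z), lscale B c (snd z))),
      lbracket = (\<lambda>zs. (lbracket B (map fst zs), lbracket B (map snd zs)))\<rparr>"

text \<open>
  Centrality relative to the abelian algebras, whose reflection is \<open>L / L\<^sub>0[L]\<close>: the two
  projections agree on \<open>L\<^sub>0[R[f]]\<close>.
\<close>

definition central_extension ::
  "nat \<Rightarrow> ('k::field, 'b::ab_group_add) leibniz_struct \<Rightarrow> ('b \<Rightarrow> 'a) \<Rightarrow> bool" where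
  "central_extension n B f \<longleftrightarrow> (\<forall>z\<in>L0 n (kernel_pair B f). fst z = snd z)"

text \<open>
  The kernel of \<^term>\<open>fst\<close> on \<open>L\<^sub>0[R[f]]\<close>, seen as a subset of \<open>B\<close> via \<^term>\<open>snd\<close>.
\<close>

definition L1 ::
  "nat \<Rightarrow> ('k::field, 'b::ab_group_add) leibniz_struct \<Rightarrow> ('b \<Rightarrow> 'a) \<Rightarrow> 'b set" where
  "L1 n B f = {k \<in> lcarrier B. (0, k) \<in> L0 n (kernel_pair B f)}"

end

theory Submission
  imports Defs
begin

text \<open>
  Write \<open>R\<close> for the kernel pair of \<open>f\<close>, \<open>K\<close> for its kernel and \<open>M = [K, B, \<dots>, B]\<close>. Everything
  follows from comparing \<open>M\<close> with \<open>L\<^sub>0[R]\<close>, in two steps.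

  The slice of \<open>L\<^sub>0[R]\<close> over \<open>0\<close>, which is \<open>L\<^sub>1[f]\<close>, contains \<open>M\<close>. Given a tuple of \<open>B\<close> with an
  entry \<open>k\<close> in \<open>K\<close>, replace this entry by \<open>(0, k)\<close> and every other entry \<open>x\<close> by \<open>(x, x)\<close>. The
  result is a tuple of \<open>R\<close> whose bracket has first component \<open>0\<close>, by multilinearity, and second
  component the bracket of the given tuple (\<open>bracket_slice\<close>). So the slice contains the generators
  of \<open>M\<close>, and the same substitution shows that it is an ideal (\<open>ideal_L1\<close>).

  Conversely \<open>y - x \<in> M\<close> for every \<open>(x, y) \<in> L\<^sub>0[R]\<close>. For a tuple of \<open>R\<close> with components
  \<open>(x\<^sub>i, y\<^sub>i)\<close>, pass from \<open>[x\<^sub>1, \<dots>, x\<^sub>n]\<close> to \<open>[y\<^sub>1, \<dots>, y\<^sub>n]\<close> by changing one entry at a time;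
  each change adds a bracket with the entry \<open>y\<^sub>i - x\<^sub>i \<in> K\<close> (\<open>bracket_diff_mem\<close>). The pairs of
  \<open>R\<close> whose difference lies in \<open>M\<close> therefore contain all brackets of \<open>R\<close>, and a subspace that
  contains all brackets is an ideal (\<open>L0_kernel_pair_diff\<close>).

  Taking \<open>x = 0\<close> in the second step gives \<open>L\<^sub>1[f] \<subseteq> M\<close>, hence equality. If \<open>M = 0\<close>, that step says that the
  projections agree on \<open>L\<^sub>0[R]\<close>; if they agree, the slice over \<open>0\<close> is trivial, hence so is \<open>M\<close>.
\<close>

section \<open>Tuples and generators of commutators\<close>

lemma tuples_update:
  "xs \<in> tuples n X \<Longrightarrow> x \<in> X \<Longrightarrow> xs[i := x] \<in> tuples n X"
  using set_update_subset_insert[of xs i x] by (auto simp: tuples_def)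

lemma tuples_nth: "xs \<in> tuples n X \<Longrightarrow> i < n \<Longrightarrow> xs ! i \<in> X"
  by (auto simp: tuples_def)

lemma list_all2_mem_replicate:
  "list_all2 (\<in>) ys (replicate n X) \<longleftrightarrow> ys \<in> tuples n X"
  by (auto simp: list_all2_conv_all_nth tuples_def set_conv_nth)

lemma tuples_mset_cong: "mset xs = mset ys \<Longrightarrow> xs \<in> tuples n X \<longleftrightarrow> ys \<in> tuples n X"
  by (auto simp: tuples_def dest: mset_eq_setD mset_eq_length)

text \<open>
  The permutations in the definition of the commutator only serve to let the distinguished entry
  stand anywhere.
\<close>

lemma commutator_replicate_Cons:
  assumes "n > 0" "X \<subseteq> Y"
  shows "commutator n L (X # replicate (n - 1) Y) =
    leibniz_ideal n L hull {lbracket L xs | xs. xs \<in> tuples n Y \<and> (\<exists>i<n. xs ! i \<in> X)}"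
proof -
  have "(\<exists>ys. mset ys = mset xs \<and> list_all2 (\<in>) ys (X # replicate (n - 1) Y)) \<longleftrightarrow>
      xs \<in> tuples n Y \<and> (\<exists>i<n. xs ! i \<in> X)" (is "?l \<longleftrightarrow> ?r") for xs
  proof
    assume ?l
    then obtain y ys where ys: "mset (y # ys) = mset xs" "y \<in> X" "ys \<in> tuples (n - 1) Y"
      by (auto simp: list_all2_Cons2 list_all2_mem_replicate)
    then have "y # ys \<in> tuples n Y"
      using assms by (auto simp: tuples_def)
    then have "xs \<in> tuples n Y"
      using tuples_mset_cong[OF ys(1)] by simp
    moreover have "y \<in> set xs"
      using mset_eq_setD[OF ys(1)] by auto
    ultimately show ?r
      using ys(2) by (auto simp: in_set_conv_nth tuples_def)
  next
    assume ?r
    then obtain i where i: "i < n" "xs ! i \<in> X" and xs: "xs \<in> tuples n Y" by blast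
    let ?ys = "xs ! i # take i xs @ drop (Suc i) xs"
    have "i < length xs" using i xs by (simp add: tuples_def)
    then have "mset xs = mset (take i xs @ xs ! i # drop (Suc i) xs)"
      by (simp flip: id_take_nth_drop)
    then have m: "mset ?ys = mset xs"
      by simp
    then have "?ys \<in> tuples n Y"
      using tuples_mset_cong[OF m] xs by simp
    then have "list_all2 (\<in>) ?ys (X # replicate (n - 1) Y)"
      using i(2) by (auto simp: list_all2_mem_replicate tuples_def)
    then show ?l using m by blast
  qed
  then show ?thesis
    unfolding commutator_def by (intro arg_cong[where f = "(hull) _"] Collect_cong) blast
qed

lemma L0_eq:
  "L0 n L = leibniz_ideal n L hull (lbracket L ` tuples n (lcarrier L))"
proof -
  have "{lbracket L xs | xs ys. mset ys = mset xs \<and> ys \<in> tuples n (lcarrier L)} =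
      lbracket L ` tuples n (lcarrier L)"
    using tuples_mset_cong by blast
  then show ?thesis
    by (simp add: L0_def commutator_def list_all2_mem_replicate)
qed

section \<open>Ideals and differences of brackets\<close>

context leibniz_algebra
begin

lemma ideal_carrier: "leibniz_ideal n L (lcarrier L)"
  by (simp add: leibniz_ideal_def subspace_carrier bracket_closed)

lemma ideal_hull:
  assumes "S \<subseteq> lcarrier L"
  shows "leibniz_ideal n L (leibniz_ideal n L hull S)"
proof -
  have "leibniz_ideal n L hull S \<subseteq> lcarrier L"
    using assms ideal_carrier by (rule hull_minimal)
  moreover have "subspace (leibniz_ideal n L hull S)"
    unfolding hull_def by (rule subspace_Inter) (auto simp: leibniz_ideal_def)
  moreover have "lbracket L xs \<in> leibniz_ideal n L hull S"
    if "xs \<in> tuples n (lcarrier L)" "i < n" "xs ! i \<in> leibniz_ideal n L hull S" for xs i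
    using that unfolding hull_def leibniz_ideal_def by blast
  ultimately show ?thesis
    unfolding leibniz_ideal_def by blast
qed

lemma bracket_zero:
  assumes "xs \<in> tuples n (lcarrier L)" "i < n"
  shows "lbracket L (xs[i := 0]) = 0"
  using bracket_scale[OF assms, of 0 0] subspace_0[OF subspace_carrier] by simp

text \<open>
  Telescoping: exchanging the entries of \<open>xs\<close> for those of \<open>ys\<close> from left to right, each exchange
  changes the bracket by a bracket that has an entry in \<open>X\<close>.
\<close>

lemma bracket_diff_mem:
  assumes xs: "xs \<in> tuples n (lcarrier L)" and ys: "ys \<in> tuples n (lcarrier L)"
    and diff: "\<And>i. i < n \<Longrightarrow> ys ! i - xs ! i \<in> X"
    and N: "subspace N"
    and brackets: "\<And>zs i. \<lbrakk>zs \<in> tuples n (lcarrier L); i < n; zs ! i \<in> X\<rbrakk> \<Longrightarrow> lbracket L zs \<in> N"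
  shows "lbracket L ys - lbracket L xs \<in> N"
proof -
  have "lbracket L (take k ys @ drop k xs) - lbracket L xs \<in> N" if "k \<le> n" for k
    using that
  proof (induction k)
    case 0
    then show ?case using subspace_0[OF N] by simp
  next
    case (Suc k)
    define zs where "zs = take k ys @ drop k xs"
    define d where "d = ys ! k - xs ! k"
    have k: "k < n" "k < length xs" "k < length ys"
      using Suc.prems xs ys by (auto simp: tuples_def)
    have zs: "zs \<in> tuples n (lcarrier L)"
      using xs ys k unfolding tuples_def zs_def by (auto dest: in_set_takeD in_set_dropD)
    have d: "d \<in> lcarrier L"
      unfolding d_def using subspace_diff[OF subspace_carrier] tuples_nth xs ys k(1) by metis
    have "zs ! k = xs ! k"
      using k by (simp add: zs_def nth_append)
    then have old: "zs[k := xs ! k] = zs"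
      by (metis list_update_id)
    have new: "take (Suc k) ys @ drop (Suc k) xs = zs[k := xs ! k + d]"
      using k by (simp add: zs_def d_def list_update_append take_Suc_conv_app_nth
          flip: Cons_nth_drop_Suc)
    have "lbracket L (zs[k := xs ! k + d]) = lbracket L zs + lbracket L (zs[k := d])"
      using bracket_add[OF zs k(1) tuples_nth[OF xs k(1)] d] old by simp
    moreover have "lbracket L (zs[k := d]) \<in> N"
      using brackets[OF tuples_update[OF zs d] k(1)] diff[OF k(1)] zs k(1)
      by (simp add: d_def tuples_def)
    moreover have "lbracket L zs - lbracket L xs \<in> N"
      using Suc by (simp add: zs_def)
    ultimately show ?case
      unfolding new using subspace_add[OF N] by (metis add_diff_eq add.commute)
  qed
  from this[of n] show ?thesis
    using xs ys by (simp add: tuples_def)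
qed

end

section \<open>The kernel pair as a Leibniz algebra\<close>

context leibniz_extension
begin

lemma hom_add: "x \<in> lcarrier B \<Longrightarrow> y \<in> lcarrier B \<Longrightarrow> f (x + y) = f x + f y"
  and hom_scale: "x \<in> lcarrier B \<Longrightarrow> f (lscale B c x) = lscale A c (f x)"
  and hom_bracket: "xs \<in> tuples n (lcarrier B) \<Longrightarrow> f (lbracket B xs) = lbracket A (map f xs)"
  using hom unfolding leibniz_hom_def by blast+

lemma hom_zero: "f 0 = 0"
  using hom_add[of 0 0] B.subspace_0[OF B.subspace_carrier] by simp

lemma hom_diff:
  assumes "x \<in> lcarrier B" "y \<in> lcarrier B"
  shows "f (x - y) = f x - f y"
  using hom_add[of "x - y" y] B.subspace_diff[OF B.subspace_carrier assms] assms
  by (simp add: eq_diff_eq)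

lemma mem_kernel_pair:
  "z \<in> lcarrier (kernel_pair B f) \<longleftrightarrow>
     fst z \<in> lcarrier B \<and> snd z \<in> lcarrier B \<and> f (fst z) = f (snd z)"
  by (auto simp: kernel_pair_def split: prod.split)

lemma lscale_kernel_pair:
  "lscale (kernel_pair B f) c z = (lscale B c (fst z), lscale B c (snd z))"
  by (simp add: kernel_pair_def)

lemma lbracket_kernel_pair:
  "lbracket (kernel_pair B f) zs = (lbracket B (map fst zs), lbracket B (map snd zs))"
  by (simp add: kernel_pair_def)

lemma tuples_kernel_pair:
  "zs \<in> tuples m (lcarrier (kernel_pair B f)) \<longleftrightarrow>
     map fst zs \<in> tuples m (lcarrier B) \<and> map snd zs \<in> tuples m (lcarrier B) \<and>
     map f (map fst zs) = map f (map snd zs)"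
  by (auto simp: tuples_def mem_kernel_pair subset_iff)

lemma leibniz_algebra_kernel_pair: "leibniz_algebra n (kernel_pair B f)"
proof -
  let ?R = "kernel_pair B f"
  interpret R: vector_space "lscale ?R"
    by unfold_locales
      (auto simp: lscale_kernel_pair prod_eq_iff B.scale_right_distrib B.scale_left_distrib)
  show ?thesis
  proof
    show "R.subspace (lcarrier ?R)"
      by (rule R.subspaceI)
        (auto simp: mem_kernel_pair lscale_kernel_pair hom_add hom_scale
          B.subspace_0[OF B.subspace_carrier] B.subspace_add[OF B.subspace_carrier]
          B.subspace_scale[OF B.subspace_carrier])
  next
    fix zs assume "zs \<in> tuples n (lcarrier ?R)"
    then show "lbracket ?R zs \<in> lcarrier ?R"
      unfolding tuples_kernel_pair
      by (simp add: mem_kernel_pair lbracket_kernel_pair B.bracket_closed hom_bracket del: map_map)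
  next
    fix zs i z w
    assume "zs \<in> tuples n (lcarrier ?R)" "i < n" "z \<in> lcarrier ?R" "w \<in> lcarrier ?R"
    then show "lbracket ?R (zs[i := z + w]) = lbracket ?R (zs[i := z]) + lbracket ?R (zs[i := w])"
      by (simp add: tuples_kernel_pair mem_kernel_pair lbracket_kernel_pair map_update
          B.bracket_add)
  next
    fix zs i z c
    assume "zs \<in> tuples n (lcarrier ?R)" "i < n" "z \<in> lcarrier ?R"
    then show "lbracket ?R (zs[i := lscale ?R c z]) = lscale ?R c (lbracket ?R (zs[i := z]))"
      by (simp add: tuples_kernel_pair mem_kernel_pair lbracket_kernel_pair lscale_kernel_pair
          map_update B.bracket_scale)
  next
    fix zs ws
    assume zs: "zs \<in> tuples n (lcarrier ?R)" and ws: "ws \<in> tuples (n - 1) (lcarrier ?R)"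
    have "length zs = n" using zs by (simp add: tuples_def)
    then show "lbracket ?R (lbracket ?R zs # ws) =
        (\<Sum>i<n. lbracket ?R (zs[i := lbracket ?R (zs ! i # ws)]))"
      using zs ws
      by (simp add: tuples_kernel_pair lbracket_kernel_pair prod_eq_iff fst_sum snd_sum
          map_update B.leibniz_identity)
  qed
qed

sublocale R: leibniz_algebra n "kernel_pair B f"
  by (rule leibniz_algebra_kernel_pair)

lemma ideal_L0_kernel_pair:
  "leibniz_ideal n (kernel_pair B f) (L0 n (kernel_pair B f))"
  unfolding L0_eq by (rule R.ideal_hull) (auto intro: R.bracket_closed)

lemma bracket_mem_L0_kernel_pair:
  "zs \<in> tuples n (lcarrier (kernel_pair B f)) \<Longrightarrow>
     lbracket (kernel_pair B f) zs \<in> L0 n (kernel_pair B f)"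
  unfolding L0_eq by (rule hull_inc) simp

lemma mem_kernel_iff: "k \<in> leibniz_kernel B f \<longleftrightarrow> (0, k) \<in> lcarrier (kernel_pair B f)"
  using B.subspace_0[OF B.subspace_carrier]
  by (auto simp: leibniz_kernel_def mem_kernel_pair hom_zero)

section \<open>Comparison of \<open>L\<^sub>1[f]\<close> with \<open>[K, B, \<dots>, B]\<close>\<close>

text \<open>
  In the first component one entry is \<open>0\<close>, so multilinearity kills the bracket there. The other
  entries are lifted along the diagonal, which keeps them in the kernel pair.
\<close>

lemma bracket_slice:
  assumes xs: "xs \<in> tuples n (lcarrier B)" and i: "i < n"
    and K: "xs ! i \<in> leibniz_kernel B f"
  defines "zs \<equiv> (map (\<lambda>x. (x, x)) xs)[i := (0, xs ! i)]"
  shows "zs \<in> tuples n (lcarrier (kernel_pair B f))"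
    and "lbracket (kernel_pair B f) zs = (0, lbracket B xs)"
proof -
  have "map (\<lambda>x. (x, x)) xs \<in> tuples n (lcarrier (kernel_pair B f))"
    using xs by (simp add: tuples_kernel_pair comp_def)
  then show "zs \<in> tuples n (lcarrier (kernel_pair B f))"
    unfolding zs_def using K mem_kernel_iff by (blast intro: tuples_update)
  show "lbracket (kernel_pair B f) zs = (0, lbracket B xs)"
    using B.bracket_zero[OF xs i]
    by (simp add: zs_def lbracket_kernel_pair map_update comp_def)
qed

abbreviation central_commutator :: "'b set" where
  "central_commutator \<equiv>
     commutator n B (leibniz_kernel B f # replicate (n - 1) (lcarrier B))"

lemma central_commutator_eq:
  assumes "n > 0"
  shows "central_commutator = leibniz_ideal n B hull
    {lbracket B xs | xs. xs \<in> tuples n (lcarrier B) \<and> (\<exists>i<n. xs ! i \<in> leibniz_kernel B f)}"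
  using assms by (intro commutator_replicate_Cons) (auto simp: leibniz_kernel_def)

lemma ideal_central_commutator:
  assumes "n > 0"
  shows "leibniz_ideal n B central_commutator"
  unfolding central_commutator_eq[OF assms]
  by (rule B.ideal_hull) (auto intro: B.bracket_closed)

text \<open>
  An element \<open>k\<close> of \<open>L\<^sub>1[f]\<close> lies in the kernel of \<open>f\<close>, since \<open>(0, k)\<close> is in the kernel pair;
  so a bracket with the entry \<open>k\<close> lifts to a bracket of the kernel pair over \<open>0\<close>.
\<close>

lemma ideal_L1: "leibniz_ideal n B (L1 n B f)"
proof -
  let ?R = "kernel_pair B f"
  note I = ideal_L0_kernel_pair
  have sub: "R.subspace (L0 n ?R)" and le: "L0 n ?R \<subseteq> lcarrier ?R"
    using I unfolding leibniz_ideal_def by auto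
  have "B.subspace (L1 n B f)"
  proof (rule B.subspaceI)
    show "0 \<in> L1 n B f"
      using R.subspace_0[OF sub] B.subspace_0[OF B.subspace_carrier]
      by (simp add: L1_def zero_prod_def)
  next
    fix x y assume "x \<in> L1 n B f" "y \<in> L1 n B f"
    then show "x + y \<in> L1 n B f"
      using R.subspace_add[OF sub, of "(0, x)" "(0, y)"] B.subspace_add[OF B.subspace_carrier]
      by (simp add: L1_def)
  next
    fix c x assume "x \<in> L1 n B f"
    then show "lscale B c x \<in> L1 n B f"
      using R.subspace_scale[OF sub, of "(0, x)" c] B.subspace_scale[OF B.subspace_carrier]
      by (simp add: L1_def lscale_kernel_pair)
  qed
  moreover have "lbracket B xs \<in> L1 n B f"
    if xs: "xs \<in> tuples n (lcarrier B)" and i: "i < n" "xs ! i \<in> L1 n B f" for xs i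
  proof -
    have "(0, xs ! i) \<in> L0 n ?R"
      using i(2) by (simp add: L1_def)
    then have "xs ! i \<in> leibniz_kernel B f"
      using le mem_kernel_iff by blast
    from bracket_mem_L0_kernel_pair[OF bracket_slice(1)[OF xs i(1) this]]
    show ?thesis
      using bracket_slice(2)[OF xs i(1) \<open>xs ! i \<in> leibniz_kernel B f\<close>] B.bracket_closed[OF xs]
      by (simp add: L1_def)
  qed
  ultimately show ?thesis
    unfolding leibniz_ideal_def by (auto simp: L1_def)
qed

lemma commutator_kernel_le_L1:
  assumes "n > 0"
  shows "central_commutator \<subseteq> L1 n B f"
  unfolding central_commutator_eq[OF assms]
proof (rule hull_minimal)
  show "{lbracket B xs | xs. xs \<in> tuples n (lcarrier B) \<and>
      (\<exists>i<n. xs ! i \<in> leibniz_kernel B f)} \<subseteq> L1 n B f"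
    using bracket_mem_L0_kernel_pair[OF bracket_slice(1)] bracket_slice(2) B.bracket_closed
    by (fastforce simp: L1_def)
qed (rule ideal_L1)

text \<open>
  The pairs whose difference lies in \<open>[K, B, \<dots>, B]\<close> form a subspace that contains all brackets of
  the kernel pair, hence an ideal above \<open>L\<^sub>0\<close>.
\<close>

lemma L0_kernel_pair_diff:
  assumes "n > 0" and z: "z \<in> L0 n (kernel_pair B f)"
  shows "snd z - fst z \<in> central_commutator"
proof -
  let ?R = "kernel_pair B f"
  let ?M = central_commutator
  define N where "N = {z \<in> lcarrier ?R. snd z - fst z \<in> ?M}"
  have sub: "B.subspace ?M"
    using ideal_central_commutator[OF assms(1)] by (simp add: leibniz_ideal_def)
  have brackets: "lbracket ?R zs \<in> N" if zs: "zs \<in> tuples n (lcarrier ?R)" for zs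
  proof -
    have "lbracket B (map snd zs) - lbracket B (map fst zs) \<in> ?M"
    proof (rule B.bracket_diff_mem[OF _ _ _ sub])
      show "map fst zs \<in> tuples n (lcarrier B)" "map snd zs \<in> tuples n (lcarrier B)"
        using zs by (simp_all add: tuples_kernel_pair)
    next
      fix i assume i: "i < n"
      then have "zs ! i \<in> lcarrier ?R" using tuples_nth[OF zs] by simp
      moreover have "length zs = n" using zs by (simp add: tuples_def)
      ultimately show "map snd zs ! i - map fst zs ! i \<in> leibniz_kernel B f"
        using i B.subspace_diff[OF B.subspace_carrier]
        by (simp add: leibniz_kernel_def mem_kernel_pair hom_diff)
    next
      fix xs i
      assume "xs \<in> tuples n (lcarrier B)" "i < n" "xs ! i \<in> leibniz_kernel B f"
      then show "lbracket B xs \<in> ?M"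
        unfolding central_commutator_eq[OF assms(1)] by (intro hull_inc) blast
    qed
    then show ?thesis
      using R.bracket_closed[OF zs] by (simp add: N_def lbracket_kernel_pair)
  qed
  have "R.subspace N"
  proof (rule R.subspaceI)
    show "0 \<in> N"
      using R.subspace_0[OF R.subspace_carrier] B.subspace_0[OF sub] by (simp add: N_def)
  next
    fix x y assume "x \<in> N" "y \<in> N"
    then show "x + y \<in> N"
      using R.subspace_add[OF R.subspace_carrier]
        B.subspace_add[OF sub, of "snd x - fst x" "snd y - fst y"]
      by (simp add: N_def algebra_simps)
  next
    fix c x assume "x \<in> N"
    then show "lscale ?R c x \<in> N"
      using R.subspace_scale[OF R.subspace_carrier]
        B.subspace_scale[OF sub, of "snd x - fst x" c]
      by (simp add: N_def lscale_kernel_pair B.scale_right_diff_distrib)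
  qed
  then have "leibniz_ideal n ?R N"
    using brackets by (auto simp: leibniz_ideal_def N_def)
  then have "L0 n ?R \<subseteq> N"
    unfolding L0_eq using brackets by (intro hull_minimal) auto
  then show ?thesis using z by (auto simp: N_def)
qed

lemma L1_eq_central_commutator:
  assumes "n > 0"
  shows "L1 n B f = central_commutator"
proof
  show "L1 n B f \<subseteq> central_commutator"
    using L0_kernel_pair_diff[OF assms] by (fastforce simp: L1_def)
qed (rule commutator_kernel_le_L1[OF assms])

lemma central_extension_iff:
  assumes "n > 0"
  shows "central_extension n B f \<longleftrightarrow> central_commutator = {0}"
proof
  assume "central_extension n B f"
  then have "L1 n B f \<subseteq> {0}"
    by (auto simp: central_extension_def L1_def)
  moreover have "0 \<in> L1 n B f"
    using ideal_L1 B.subspace_0 by (simp add: leibniz_ideal_def)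
  ultimately show "central_commutator = {0}"
    using L1_eq_central_commutator[OF assms] by blast
next
  assume "central_commutator = {0}"
  then show "central_extension n B f"
    using L0_kernel_pair_diff[OF assms] by (auto simp: central_extension_def)
qed

end

theorem proposition3p4:
  fixes n :: nat
    and B :: "('k::field, 'b::ab_group_add) leibniz_struct"
    and A :: "('k, 'a::ab_group_add) leibniz_struct"
    and f :: "'b \<Rightarrow> 'a"
  assumes "n \<ge> 2"
    and "leibniz_extension n B A f"
  defines "K \<equiv> leibniz_kernel B f"
  shows "(central_extension n B f \<longleftrightarrow>
            commutator n B (K # replicate (n - 1) (lcarrier B)) = {0}) \<and>
         L1 n B f = commutator n B (K # replicate (n - 1) (lcarrier B))"
proof -
  have "n > 0" using assms(1) by simp
  then show ?thesis
    unfolding K_def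
    using leibniz_extension.central_extension_iff[OF assms(2)]
      leibniz_extension.L1_eq_central_commutator[OF assms(2)]
    by simp
qed

end
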